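(* Let $k$ and $r$ be fixed integers with $k>r\ge 0$, and let $i=\sqrt{-1}$. Then for every integer $n\ge 0$, $$\sum_{m=0}^n B_{km+r}B_{k(n-m)+r}=B_{k-r}\left(-(n+1)B_{k(n+1)+r}+\sum_{j=0}^n\frac{B_kB_{k-r}^j}{2}\left(\frac{(-1)^j}{(B_k+B_r)^{j+1}}+\frac{1}{(B_k-B_r)^{j+1}}\right)(n-j+1)B_{k(n-j+1)+r}\right)$$ and $$\sum_{m=0}^n C_{km+r}C_{k(n-m)+r}=C_{k-r}\left((n+1)C_{k(n+1)+r}-\sum_{j=0}^n\frac{2\sqrt2\,B_k(C_{k-r}i)^j}{2}\left(\frac{1}{(2\sqrt2B_k+C_ri)^{j+1}}+\frac{(-1)^j}{(2\sqrt2B_k-C_ri)^{j+1}}\right)(n-j+1)C_{k(n-j+1)+r}\right).$$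
   Context: The balancing numbers are defined by $B_0=0$, $B_1=1$, $B_n=6B_{n-1}-B_{n-2}$ for $n\ge 2$. The Lucas-balancing numbers are defined by $C_0=1$, $C_1=3$, $C_n=6C_{n-1}-C_{n-2}$ for $n\ge 2$. *)

theory Defs
  imports Complex_Main
begin

fun balancing :: "nat \<Rightarrow> int" where
  "balancing 0 = 0"
| "balancing (Suc 0) = 1"
| "balancing (Suc (Suc n)) = 6 * balancing (Suc n) - balancing n"

fun lucas_balancing :: "nat \<Rightarrow> int" where
  "lucas_balancing 0 = 1"
| "lucas_balancing (Suc 0) = 3"
| "lucas_balancing (Suc (Suc n)) = 6 * lucas_balancing (Suc n) - lucas_balancing n"

text \<open>Integer values embedded in the fields over which the two identities are stated.\<close>

abbreviation B\<^sub>R :: "nat \<Rightarrow> real" where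
  "B\<^sub>R n \<equiv> of_int (balancing n)"

abbreviation B\<^sub>C :: "nat \<Rightarrow> complex" where
  "B\<^sub>C n \<equiv> of_int (balancing n)"

abbreviation C\<^sub>C :: "nat \<Rightarrow> complex" where
  "C\<^sub>C n \<equiv> of_int (lucas_balancing n)"

abbreviation sqrt2\<^sub>C :: complex where
  "sqrt2\<^sub>C \<equiv> complex_of_real (sqrt 2)"

end

(* Along an arithmetic progression of step k both sequences satisfy u (m + 2) = 2 c u (m + 1) - u m
   with c = C_k, so their generating function is f = (a + b X) / D with D = 1 - 2 c X + X^2. Put
   s^2 = a^2 + b^2 + 2 a b c. Then b f' D^2 = s^2 - (a + b X)^2 = (s - a - b X) (s + a + b X), hence
   f^2 = -b f' + s^2 / D^2, and partial fractions turn s^2 / D^2 into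
   b f' (s / 2) (1 / (s - a - b X) + 1 / (s + a + b X)). The two identities compare coefficients,
   with (a, b, s) = (B_r, B_{k-r}, B_k) and (a, b, s) = (C_r, -C_{k-r}, 2 sqrt 2 B_k i). *)
theory Submission
  imports Defs "HOL-Computational_Algebra.Formal_Power_Series"
begin

section \<open>Squares of generating functions of second-order recurrences\<close>

lemma fps_geometric_inverse:
  includes fps_syntax
  fixes p q :: "'a::field"
  assumes "p \<noteq> 0"
  shows "(fps_const p - fps_const q * fps_X) * Abs_fps (\<lambda>j. q ^ j / p ^ (j + 1)) = 1"
proof (rule fps_ext)
  fix n
  show "((fps_const p - fps_const q * fps_X) * Abs_fps (\<lambda>j. q ^ j / p ^ (j + 1))) $ n = 1 $ n"
    using assms by (cases n) (simp_all add: algebra_simps)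
qed

text \<open>Running the recurrence backwards gives u(-1) = 2 c u(0) - u(1), so \<open>b\<close> is
  -u(-1). The condition on \<open>s\<close> makes the quadratic that arises from the derivative a
  difference of two squares, and \<open>ne\<close> makes both of its linear factors invertible as
  power series.\<close>

lemma convolution_square_linear_recurrence:
  includes fps_syntax
  fixes u :: "nat \<Rightarrow> 'a::field_char_0"
  assumes rec: "\<And>m. u (m + 2) = 2 * c * u (m + 1) - u m"
    and u1: "u 1 = b + 2 * c * u 0"
    and s: "s\<^sup>2 = (u 0)\<^sup>2 + b\<^sup>2 + 2 * u 0 * b * c"
    and ne: "s - u 0 \<noteq> 0" "s + u 0 \<noteq> 0"
  shows "(\<Sum>m=0..n. u m * u (n - m)) =
    b * (- (of_nat (n + 1) * u (n + 1))
      + (\<Sum>j=0..n. s / 2 * (b ^ j / (s - u 0) ^ (j + 1) + (- b) ^ j / (s + u 0) ^ (j + 1))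
          * (of_nat (n - j + 1) * u (n - j + 1))))"
proof -
  define a where "a = u 0"
  define f where "f = Abs_fps u"
  define D :: "'a fps" where "D = 1 - 2 * fps_const c * fps_X + fps_X\<^sup>2"
  define P where "P = fps_const (s - a) - fps_const b * fps_X"
  \<comment> \<open>The double negation keeps the shape p - q X, so that the geometric series
    applies to \<open>Q\<close> as it does to \<open>P\<close>.\<close>
  define Q where "Q = fps_const (s + a) - fps_const (- b) * fps_X"
  define g where "g = Abs_fps (\<lambda>j. b ^ j / (s - a) ^ (j + 1))"
  define h where "h = Abs_fps (\<lambda>j. (- b) ^ j / (s + a) ^ (j + 1))"
  have Pg: "P * g = 1"
    using ne(1) unfolding P_def g_def a_def by (rule fps_geometric_inverse)
  have Qh: "Q * h = 1"
    using ne(2) unfolding Q_def h_def a_def by (rule fps_geometric_inverse)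
  have D': "D = 1 - fps_const (2 * c) * fps_X + fps_X * fps_X"
    by (simp add: D_def power2_eq_square numeral_fps_const)
  have fD: "f * D = fps_const a + fps_const b * fps_X"
  proof (rule fps_ext)
    fix n
    \<comment> \<open>With the powers of X in front of \<open>f\<close>, coefficients become index
      shifts: \<open>u1\<close> settles n = 1 and \<open>rec\<close> settles n >= 2.\<close>
    have "(f * D) $ n = (f - fps_const (2 * c) * (fps_X * f) + fps_X * (fps_X * f)) $ n"
      by (simp only: D' algebra_simps mult_1_left mult_1_right)
    also have "\<dots> = (fps_const a + fps_const b * fps_X) $ n"
    proof (cases n)
      case 0
      then show ?thesis by (simp add: f_def a_def)
    next
      case (Suc m)
      then show ?thesis
        using u1 rec[of "m - 1"] by (cases m) (simp_all add: f_def a_def)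
    qed
    finally show "(f * D) $ n = (fps_const a + fps_const b * fps_X) $ n" .
  qed
  have "fps_deriv (f * D) = fps_const b"
    unfolding fD by simp
  then have df: "fps_deriv f * D + f * (2 * fps_X - 2 * fps_const c) = fps_const b"
    by (simp add: D' algebra_simps numeral_fps_const flip: fps_const_mult)
  have PQ: "P * Q = fps_const s ^ 2 - (fps_const a + fps_const b * fps_X)\<^sup>2"
    by (simp add: P_def Q_def algebra_simps power2_eq_square
        flip: fps_const_add fps_const_sub fps_const_mult fps_const_neg)
  have sc: "fps_const s ^ 2
      = fps_const a ^ 2 + fps_const b ^ 2 + 2 * fps_const a * fps_const b * fps_const c"
    using arg_cong[OF s, of fps_const]
    by (simp add: a_def numeral_fps_const fps_const_power)
  \<comment> \<open>Multiplying by one more \<open>D\<close> leaves \<open>f\<close> only inside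
    \<open>f * D\<close>, which is the known linear polynomial.\<close>
  have "fps_deriv f * D\<^sup>2 = fps_const b * D - (f * D) * (2 * fps_X - 2 * fps_const c)"
    unfolding df[symmetric] by (simp add: algebra_simps power2_eq_square)
  then have "fps_const b * fps_deriv f * D\<^sup>2
      = fps_const b * (fps_const b * D - (f * D) * (2 * fps_X - 2 * fps_const c))"
    by (simp only: mult.assoc)
  also have "\<dots> = P * Q"
    unfolding PQ sc fD by (simp add: D_def algebra_simps power2_eq_square flip: fps_const_mult)
  finally have bf: "fps_const b * fps_deriv f * D\<^sup>2 = P * Q" .
  have half: "fps_const (s / 2) * 2 = fps_const s"
    by (simp add: numeral_fps_const)
  \<comment> \<open>Partial fractions: \<open>g\<close> and \<open>h\<close> are the inverses of
    \<open>P\<close> and \<open>Q\<close>, and P + Q = 2 s because \<open>a\<close> and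
    \<open>b\<close> cancel.\<close>
  have PQgh: "P * Q * (g + h) = fps_const s * 2"
  proof -
    have "P * Q * (g + h) = (P * g) * Q + P * (Q * h)"
      by (simp add: algebra_simps)
    also have "\<dots> = Q + P"
      by (simp add: Pg Qh)
    also have "\<dots> = fps_const s * 2"
      by (simp add: P_def Q_def mult_2_right flip: fps_const_add fps_const_sub fps_const_neg)
    finally show ?thesis .
  qed
  \<comment> \<open>\<open>R\<close> generates the right-hand sides for all n at once. Multiplied by
    D^2 it becomes - P Q + s^2 = (a + b X)^2 = (f D)^2, and D^2 can then be cancelled.\<close>
  define R where "R = fps_const b * (- fps_deriv f + fps_const (s / 2) * (g + h) * fps_deriv f)"
  have "R * D\<^sup>2 = - (fps_const b * fps_deriv f * D\<^sup>2)
      + fps_const (s / 2) * ((fps_const b * fps_deriv f * D\<^sup>2) * (g + h))"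
    by (simp add: R_def algebra_simps)
  also have "\<dots> = - (P * Q) + fps_const s ^ 2"
    unfolding bf PQgh using half by (simp add: power2_eq_square mult_ac)
  also have "\<dots> = (f * f) * D\<^sup>2"
    unfolding PQ fD[symmetric] by (simp add: power2_eq_square algebra_simps)
  finally have "R * D\<^sup>2 = (f * f) * D\<^sup>2" .
  moreover have "D $ 0 = 1"
    by (simp add: D')
  then have "D \<noteq> 0"
    by auto
  ultimately have "f * f = R"
    by simp
  then have "(f * f) $ n = R $ n"
    by simp
  moreover have "(f * f) $ n = (\<Sum>m=0..n. u m * u (n - m))"
    by (simp add: fps_mult_nth f_def)
  \<comment> \<open>The weights come from the derivative, whose coefficient at i is (i + 1) u(i +
    1).\<close>
  moreover have "R $ n = b * (- (of_nat (n + 1) * u (n + 1))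
      + (\<Sum>j=0..n. s / 2 * (b ^ j / (s - a) ^ (j + 1) + (- b) ^ j / (s + a) ^ (j + 1))
          * (of_nat (n - j + 1) * u (n - j + 1))))"
    unfolding R_def fps_mult_left_const_nth fps_add_nth fps_neg_nth fps_mult_nth[of _ "fps_deriv f"]
    by (simp add: g_def h_def f_def del: of_nat_Suc)
  ultimately show ?thesis
    by (simp add: a_def)
qed

section \<open>Addition formulas and the Pell equation\<close>

text \<open>Behind both rules stands C_n + B_n sqrt 8 = (3 + sqrt 8)^n: one step is multiplication
  by 3 + sqrt 8. The addition formulas below multiply two such powers, and the Pell equation says
  that their norm is 1.\<close>

lemma balancing_Suc: "balancing (Suc n) = 3 * balancing n + lucas_balancing n"
  and lucas_balancing_Suc: "lucas_balancing (Suc n) = 3 * lucas_balancing n + 8 * balancing n"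
proof -
  have "balancing (Suc n) = 3 * balancing n + lucas_balancing n \<and>
      lucas_balancing (Suc n) = 3 * lucas_balancing n + 8 * balancing n"
    by (induction n rule: balancing.induct) auto
  then show "balancing (Suc n) = 3 * balancing n + lucas_balancing n"
    and "lucas_balancing (Suc n) = 3 * lucas_balancing n + 8 * balancing n"
    by auto
qed

lemma balancing_add:
    "balancing (m + n) = balancing m * lucas_balancing n + lucas_balancing m * balancing n"
  and lucas_balancing_add:
    "lucas_balancing (m + n) = lucas_balancing m * lucas_balancing n + 8 * balancing m * balancing n"
proof -
  have "balancing (m + n) = balancing m * lucas_balancing n + lucas_balancing m * balancing n \<and>
      lucas_balancing (m + n) = lucas_balancing m * lucas_balancing n + 8 * balancing m * balancing n"
    by (induction m)
      (auto simp: balancing_Suc lucas_balancing_Suc algebra_simps simp del: balancing.simps(3) lucas_balancing.simps(3))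
  then show "balancing (m + n) = balancing m * lucas_balancing n + lucas_balancing m * balancing n"
    and "lucas_balancing (m + n) = lucas_balancing m * lucas_balancing n + 8 * balancing m * balancing n"
    by auto
qed

lemma lucas_balancing_pell: "(lucas_balancing n)\<^sup>2 = 8 * (balancing n)\<^sup>2 + 1"
  by (induction n) (auto simp: balancing_Suc lucas_balancing_Suc power2_eq_square algebra_simps)

lemma lucas_balancing_pos: "lucas_balancing n > 0"
  and balancing_nonneg: "balancing n \<ge> 0"
proof -
  have "lucas_balancing n > 0 \<and> balancing n \<ge> 0"
    by (induction n) (auto simp: balancing_Suc lucas_balancing_Suc)
  then show "lucas_balancing n > 0" "balancing n \<ge> 0"
    by auto
qed

text \<open>The increment is 2 B_n + C_n > 0. Strictness keeps the denominators of both identities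
  away from zero.\<close>

lemma strict_mono_balancing: "strict_mono balancing"
  unfolding strict_mono_Suc_iff
proof
  fix n
  show "balancing n < balancing (Suc n)"
    using lucas_balancing_pos[of n] balancing_nonneg[of n] by (simp add: balancing_Suc)
qed

section \<open>Recurrences along arithmetic progressions\<close>

text \<open>The number C_k + B_k sqrt 8 has trace 2 C_k and norm 1, hence is a root of X^2 - 2 C_k X
  + 1. The same holds for the Lucas-balancing numbers.\<close>

lemma balancing_progression:
  "balancing (k * (m + 2) + r) = 2 * lucas_balancing k * balancing (k * (m + 1) + r) - balancing (k * m + r)"
proof -
  define x where "x = k * m + r"
  have e: "k * (m + 2) + r = k + (k + x)" "k * (m + 1) + r = k + x"
    by (simp_all add: x_def algebra_simps)
  show ?thesis
    unfolding e x_def[symmetric] balancing_add lucas_balancing_add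
    using lucas_balancing_pell[of k] by algebra
qed

lemma lucas_balancing_progression:
  "lucas_balancing (k * (m + 2) + r) =
    2 * lucas_balancing k * lucas_balancing (k * (m + 1) + r) - lucas_balancing (k * m + r)"
proof -
  define x where "x = k * m + r"
  have e: "k * (m + 2) + r = k + (k + x)" "k * (m + 1) + r = k + x"
    by (simp_all add: x_def algebra_simps)
  show ?thesis
    unfolding e x_def[symmetric] balancing_add lucas_balancing_add
    using lucas_balancing_pell[of k] by algebra
qed

text \<open>These supply the initial values and the \<open>s\<close> of the general convolution
  lemma. After writing k = d + r, each is a polynomial identity in the values at d and r modulo
  their Pell equations. The signs differ because B extends to negative indices as an odd function
  and C as an even one. The negative left-hand side of the last law is why the second identity needs
  complex numbers.\<close>

lemma
  assumes "r \<le> k"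
  shows balancing_add_diff: "balancing (k + r) = balancing (k - r) + 2 * lucas_balancing k * balancing r"
    and lucas_balancing_add_diff:
      "lucas_balancing (k + r) = - lucas_balancing (k - r) + 2 * lucas_balancing k * lucas_balancing r"
    and balancing_cosine_law: "(balancing k)\<^sup>2 =
      (balancing r)\<^sup>2 + (balancing (k - r))\<^sup>2 + 2 * balancing r * balancing (k - r) * lucas_balancing k"
    and lucas_balancing_cosine_law: "- 8 * (balancing k)\<^sup>2 =
      (lucas_balancing r)\<^sup>2 + (lucas_balancing (k - r))\<^sup>2
        - 2 * lucas_balancing r * lucas_balancing (k - r) * lucas_balancing k"
proof -
  obtain d where k: "k = d + r"
    using assms by (metis le_iff_add add.commute)
  note pell = lucas_balancing_pell[of r] lucas_balancing_pell[of d]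
  show "balancing (k + r) = balancing (k - r) + 2 * lucas_balancing k * balancing r"
    unfolding k add_diff_cancel_right' balancing_add lucas_balancing_add using pell by algebra
  show "lucas_balancing (k + r) = - lucas_balancing (k - r) + 2 * lucas_balancing k * lucas_balancing r"
    unfolding k add_diff_cancel_right' balancing_add lucas_balancing_add using pell by algebra
  show "(balancing k)\<^sup>2 =
      (balancing r)\<^sup>2 + (balancing (k - r))\<^sup>2 + 2 * balancing r * balancing (k - r) * lucas_balancing k"
    unfolding k add_diff_cancel_right' balancing_add lucas_balancing_add using pell by algebra
  show "- 8 * (balancing k)\<^sup>2 =
      (lucas_balancing r)\<^sup>2 + (lucas_balancing (k - r))\<^sup>2
        - 2 * lucas_balancing r * lucas_balancing (k - r) * lucas_balancing k"
    unfolding k add_diff_cancel_right' balancing_add lucas_balancing_add using pell by algebra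
qed

section \<open>The two convolution identities\<close>

lemma balancing_convolution:
  fixes k r n :: nat
  assumes "k > r"
  shows "(\<Sum>m=0..n. B\<^sub>R (k * m + r) * B\<^sub>R (k * (n - m) + r)) =
      B\<^sub>R (k - r) *
        (- (of_nat (n + 1) * B\<^sub>R (k * (n + 1) + r))
         + (\<Sum>j=0..n. B\<^sub>R k * B\<^sub>R (k - r) ^ j / 2
              * ((- 1) ^ j / (B\<^sub>R k + B\<^sub>R r) ^ (j + 1) + 1 / (B\<^sub>R k - B\<^sub>R r) ^ (j + 1))
              * of_nat (n - j + 1) * B\<^sub>R (k * (n - j + 1) + r)))"
proof -
  define u where "u = (\<lambda>m. B\<^sub>R (k * m + r))"
  define b where "b = B\<^sub>R (k - r)"
  define s where "s = B\<^sub>R k"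
  have u0: "u 0 = B\<^sub>R r"
    by (simp add: u_def)
  have lt: "balancing r < balancing k"
    using assms strict_mono_balancing by (simp add: strict_mono_less)
  have "s - u 0 \<noteq> 0" "s + u 0 \<noteq> 0"
    using lt balancing_nonneg[of r] unfolding s_def u0 by linarith+
  moreover have "s\<^sup>2 = (u 0)\<^sup>2 + b\<^sup>2 + 2 * u 0 * b * of_int (lucas_balancing k)"
    using arg_cong[OF balancing_cosine_law[of r k], of real_of_int] assms
    by (simp add: s_def b_def u0)
  moreover have "u 1 = b + 2 * of_int (lucas_balancing k) * u 0"
    using arg_cong[OF balancing_add_diff[of r k], of real_of_int] assms
    by (simp add: u_def b_def)
  moreover have "u (m + 2) = 2 * of_int (lucas_balancing k) * u (m + 1) - u m" for m
    unfolding u_def balancing_progression by simp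
  ultimately have "(\<Sum>m=0..n. u m * u (n - m)) =
    b * (- (of_nat (n + 1) * u (n + 1))
      + (\<Sum>j=0..n. s / 2 * (b ^ j / (s - u 0) ^ (j + 1) + (- b) ^ j / (s + u 0) ^ (j + 1))
          * (of_nat (n - j + 1) * u (n - j + 1))))"
    by (intro convolution_square_linear_recurrence)
  also have "(\<Sum>j=0..n. s / 2 * (b ^ j / (s - u 0) ^ (j + 1) + (- b) ^ j / (s + u 0) ^ (j + 1))
          * (of_nat (n - j + 1) * u (n - j + 1))) =
      (\<Sum>j=0..n. s * b ^ j / 2 * ((- 1) ^ j / (s + u 0) ^ (j + 1) + 1 / (s - u 0) ^ (j + 1))
              * of_nat (n - j + 1) * u (n - j + 1))"
  proof (rule sum.cong[OF refl])
    fix j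
    show "s / 2 * (b ^ j / (s - u 0) ^ (j + 1) + (- b) ^ j / (s + u 0) ^ (j + 1))
          * (of_nat (n - j + 1) * u (n - j + 1)) =
        s * b ^ j / 2 * ((- 1) ^ j / (s + u 0) ^ (j + 1) + 1 / (s - u 0) ^ (j + 1))
              * of_nat (n - j + 1) * u (n - j + 1)"
      unfolding power_minus[of b] by (simp only: ring_distribs times_divide_eq_left times_divide_eq_right mult_ac mult_1_left mult_1_right add_ac)
  qed
  finally show ?thesis
    unfolding u0 unfolding u_def b_def s_def .
qed

lemma lucas_balancing_convolution:
  fixes k r n :: nat
  assumes "k > r"
  shows "(\<Sum>m=0..n. C\<^sub>C (k * m + r) * C\<^sub>C (k * (n - m) + r)) =
      C\<^sub>C (k - r) *
        (of_nat (n + 1) * C\<^sub>C (k * (n + 1) + r)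
         - (\<Sum>j=0..n. 2 * sqrt2\<^sub>C * B\<^sub>C k * (C\<^sub>C (k - r) * \<i>) ^ j / 2
              * (1 / (2 * sqrt2\<^sub>C * B\<^sub>C k + C\<^sub>C r * \<i>) ^ (j + 1)
                 + (- 1) ^ j / (2 * sqrt2\<^sub>C * B\<^sub>C k - C\<^sub>C r * \<i>) ^ (j + 1))
              * of_nat (n - j + 1) * C\<^sub>C (k * (n - j + 1) + r)))"
proof -
  define u where "u = (\<lambda>m. C\<^sub>C (k * m + r))"
  define d where "d = C\<^sub>C (k - r)"
  define S where "S = 2 * sqrt2\<^sub>C * B\<^sub>C k"
  have u0: "u 0 = C\<^sub>C r"
    by (simp add: u_def)
  have "balancing 0 < balancing k"
    using assms strict_mono_balancing by (metis strict_mono_less not_gr_zero not_less_zero)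
  \<comment> \<open>Here \<open>u 0\<close> is real while \<open>\<i> * S\<close> is purely
    imaginary and nonzero, since B_k > 0.\<close>
  then have "Im (\<i> * S - u 0) \<noteq> 0" "Im (\<i> * S + u 0) \<noteq> 0"
    by (simp_all add: u0 S_def)
  then have "\<i> * S - u 0 \<noteq> 0" "\<i> * S + u 0 \<noteq> 0"
    by (metis zero_complex.simps(2))+
  moreover have "(\<i> * S)\<^sup>2 = (u 0)\<^sup>2 + (- d)\<^sup>2 + 2 * u 0 * (- d) * of_int (lucas_balancing k)"
  proof -
    have "sqrt2\<^sub>C ^ 2 = 2"
      by (metis of_real_numeral of_real_power real_sqrt_pow2 zero_le_numeral)
    then have "(\<i> * S)\<^sup>2 = of_int (- 8 * (balancing k)\<^sup>2)"
      by (simp add: S_def power_mult_distrib)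
    also have "\<dots> = (u 0)\<^sup>2 + (- d)\<^sup>2 + 2 * u 0 * (- d) * of_int (lucas_balancing k)"
      using assms by (subst lucas_balancing_cosine_law[of r k]) (simp_all add: d_def u0)
    finally show ?thesis .
  qed
  moreover have "u 1 = - d + 2 * of_int (lucas_balancing k) * u 0"
    using arg_cong[OF lucas_balancing_add_diff[of r k], of complex_of_int] assms
    by (simp add: u_def d_def)
  moreover have "u (m + 2) = 2 * of_int (lucas_balancing k) * u (m + 1) - u m" for m
    unfolding u_def lucas_balancing_progression by simp
  ultimately have "(\<Sum>m=0..n. u m * u (n - m)) =
    - d * (- (of_nat (n + 1) * u (n + 1))
      + (\<Sum>j=0..n. \<i> * S / 2 * ((- d) ^ j / (\<i> * S - u 0) ^ (j + 1) + (- (- d)) ^ j / (\<i> * S + u 0) ^ (j + 1))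
          * (of_nat (n - j + 1) * u (n - j + 1))))"
    by (intro convolution_square_linear_recurrence)
  also have "(\<Sum>j=0..n. \<i> * S / 2 * ((- d) ^ j / (\<i> * S - u 0) ^ (j + 1) + (- (- d)) ^ j / (\<i> * S + u 0) ^ (j + 1))
          * (of_nat (n - j + 1) * u (n - j + 1))) =
      (\<Sum>j=0..n. S * (d * \<i>) ^ j / 2
              * (1 / (S + u 0 * \<i>) ^ (j + 1) + (- 1) ^ j / (S - u 0 * \<i>) ^ (j + 1))
              * of_nat (n - j + 1) * u (n - j + 1))"
  proof (rule sum.cong[OF refl])
    fix j
    \<comment> \<open>The factor in front cancels one of the j + 1 copies of \<open>\<i>\<close>
      below; the other j turn x into x / \<open>\<i>\<close> = - x \<open>\<i>\<close>. Taking x = -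
      d and x = d gives the two summands, the second with the sign (-1)^j.\<close>
    have rotate: "\<i> * (x ^ j / (\<i> * y) ^ (j + 1)) = (- (x * \<i>)) ^ j / y ^ (j + 1)" for x y
    proof -
      have "(- (x * \<i>)) ^ j = (x / \<i>) ^ j"
        by (simp add: divide_i mult.commute)
      also have "\<dots> = x ^ j / \<i> ^ j"
        by (rule power_divide)
      finally show ?thesis
        by (simp add: power_mult_distrib)
    qed
    have y: "\<i> * S - u 0 = \<i> * (S + u 0 * \<i>)" "\<i> * S + u 0 = \<i> * (S - u 0 * \<i>)"
      by (simp_all add: algebra_simps)
    have first: "\<i> * ((- d) ^ j / (\<i> * S - u 0) ^ (j + 1)) = (d * \<i>) ^ j / (S + u 0 * \<i>) ^ (j + 1)"
      unfolding y rotate by simp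
    have second: "\<i> * ((- (- d)) ^ j / (\<i> * S + u 0) ^ (j + 1))
        = (d * \<i>) ^ j * ((- 1) ^ j / (S - u 0 * \<i>) ^ (j + 1))"
      unfolding y rotate minus_minus by (subst power_minus) simp
    have distrib: "\<i> * S / 2 * (v + w) * z = S / 2 * (\<i> * v + \<i> * w) * z" for v w z
      by (simp add: algebra_simps)
    show "\<i> * S / 2 * ((- d) ^ j / (\<i> * S - u 0) ^ (j + 1) + (- (- d)) ^ j / (\<i> * S + u 0) ^ (j + 1))
          * (of_nat (n - j + 1) * u (n - j + 1)) =
        S * (d * \<i>) ^ j / 2 * (1 / (S + u 0 * \<i>) ^ (j + 1) + (- 1) ^ j / (S - u 0 * \<i>) ^ (j + 1))
              * of_nat (n - j + 1) * u (n - j + 1)"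
      unfolding distrib first second
      by (simp only: ring_distribs times_divide_eq_left times_divide_eq_right mult_ac mult_1_left mult_1_right)
  qed
  \<comment> \<open>The sign of b = - d moves inside, which explains the opposite signs in the two
    identities.\<close>
  also have "- d * (- v + w) = d * (v - w)" for v w
    by (simp add: algebra_simps)
  finally show ?thesis
    unfolding u0 unfolding u_def d_def S_def .
qed

theorem theorem1:
  fixes k r n :: nat
  assumes "k > r"
  shows "(\<Sum>m=0..n. B\<^sub>R (k * m + r) * B\<^sub>R (k * (n - m) + r)) =
      B\<^sub>R (k - r) *
        (- (of_nat (n + 1) * B\<^sub>R (k * (n + 1) + r))
         + (\<Sum>j=0..n. B\<^sub>R k * B\<^sub>R (k - r) ^ j / 2
              * ((- 1) ^ j / (B\<^sub>R k + B\<^sub>R r) ^ (j + 1) + 1 / (B\<^sub>R k - B\<^sub>R r) ^ (j + 1))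
              * of_nat (n - j + 1) * B\<^sub>R (k * (n - j + 1) + r)))
    \<and>
    (\<Sum>m=0..n. C\<^sub>C (k * m + r) * C\<^sub>C (k * (n - m) + r)) =
      C\<^sub>C (k - r) *
        (of_nat (n + 1) * C\<^sub>C (k * (n + 1) + r)
         - (\<Sum>j=0..n. 2 * sqrt2\<^sub>C * B\<^sub>C k * (C\<^sub>C (k - r) * \<i>) ^ j / 2
              * (1 / (2 * sqrt2\<^sub>C * B\<^sub>C k + C\<^sub>C r * \<i>) ^ (j + 1)
                 + (- 1) ^ j / (2 * sqrt2\<^sub>C * B\<^sub>C k - C\<^sub>C r * \<i>) ^ (j + 1))
              * of_nat (n - j + 1) * C\<^sub>C (k * (n - j + 1) + r)))"
  using balancing_convolution[OF assms] lucas_balancing_convolution[OF assms] by (rule conjI)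

end
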